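(* Consider any instance of the strategic facility location game on a line metric. Then every strategic client reporting the facility location closest to them is a strong Nash equilibrium for Mechanism $GM^*$: if for each $i\in L$ the report $x_i\in\mathcal{F}$ satisfies $d(i,x_i)=\min_{A\in\mathcal{F}}d(i,A)$, then $(\vec t;\vec x)$ is a strong Nash equilibrium under $GM^*$.
   Context: Setting (line metric). The metric space is the real line $\mathbb{R}$ with $d(x,y)=|x-y|$. An instance consists of a set $\mathcal{C}$ of $n$ clients, each having a true location on the line (several clients may share a location; the true location of client $i$ is also denoted $i$); a finite nonempty set $\mathcal{F}\subset\mathbb{R}$ of possible facility locations, ordered from left to right (the leftmost is the lowest-numbered); and a partition $\mathcal{C}=T\cup L$, $T\cap L=\emptyset$, with $|L|=k\ge 1$, $|T|=n-k$. Clients in $T$ always report their true location; each client $i\in L$ (strategic) may report any point $x_i$ of the line. Let $\vec t$ be the vector of true locations of clients in $T$ and $\vec x=(x_i)_{i\in L}$ the vector of reports of the strategic clients. Perceived cost of $A\in\mathcal{F}$: $cost_A(\vec t;\vec x)=\sum_{i\in T}d(i,A)+\sum_{i\in L}d(x_i,A)$. Mechanism $GM^*$: given reports $(\vec t;\vec x)$, output the facility $GM^*(\vec t;\vec x)\in\mathcal{F}$ minimizing $cost_A(\vec t;\vec x)$ over $A\in\mathcal{F}$, ties broken in favor of the lowest-numbered facility. Strong Nash equilibrium (SNE) under a mechanism $M$: a profile $(\vec t;\vec x)$ such that for every nonempty set $I\subseteq L$ and every vector $x_I'$ of reports for the clients in $I$, there is a client $i\in I$ with $d(i,M(\vec t;\vec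 x_{-I},x_I'))\ge d(i,M(\vec t;\vec x))$, where $(\vec x_{-I},x_I')$ is $\vec x$ with the reports of clients in $I$ replaced by $x_I'$. *)

theory Defs
  imports Complex_Main
begin

text \<open>
  Clients are the elements of a set of abstract names, so several clients may share a location;
  facilities are identified with their points on the line, so the left-to-right numbering of the
  facilities is the order of the reals.  Vectors indexed by a set of clients are functions on the
  client type: only the values of \<open>t\<close> on \<open>T\<close> and of \<open>x\<close> on \<open>L\<close> are used.
\<close>

definition perceived_cost ::
  "'c set \<Rightarrow> 'c set \<Rightarrow> ('c \<Rightarrow> real) \<Rightarrow> ('c \<Rightarrow> real) \<Rightarrow> real \<Rightarrow> real" where
  "perceived_cost T L t x A = (\<Sum>i\<in>T. dist (t i) A) + (\<Sum>i\<in>L. dist (x i) A)"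

text \<open>The outer \<open>Min\<close> is the tie-breaking rule: the leftmost cost-minimizing facility.\<close>

definition GM_star ::
  "'c set \<Rightarrow> 'c set \<Rightarrow> real set \<Rightarrow> ('c \<Rightarrow> real) \<Rightarrow> ('c \<Rightarrow> real) \<Rightarrow> real" where
  "GM_star T L F t x =
     Min {A \<in> F. \<forall>B\<in>F. perceived_cost T L t x A \<le> perceived_cost T L t x B}"

text \<open>
  \<open>loc\<close> gives the true locations.  \<open>override_on x x' I\<close> is the vector of reports in which the
  members of \<open>I\<close> report according to \<open>x'\<close> and everybody else according to \<open>x\<close>.
\<close>

definition strong_nash_equilibrium ::
  "'c set \<Rightarrow> ('c \<Rightarrow> real) \<Rightarrow> (('c \<Rightarrow> real) \<Rightarrow> ('c \<Rightarrow> real) \<Rightarrow> real) \<Rightarrow>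
   ('c \<Rightarrow> real) \<Rightarrow> ('c \<Rightarrow> real) \<Rightarrow> bool" where
  "strong_nash_equilibrium L loc M t x \<longleftrightarrow>
     (\<forall>I x'. I \<subseteq> L \<and> I \<noteq> {} \<longrightarrow>
        (\<exists>i\<in>I. dist (loc i) (M t (override_on x x' I)) \<ge> dist (loc i) (M t x)))"

end

theory Submission
  imports Defs "HOL-Analysis.Line_Segment"
begin

text \<open>
  Suppose a coalition \<open>I\<close> moves the outcome from \<open>W\<close> to \<open>W'\<close>, which all its members strictly
  prefer, and let \<open>P\<close> be the first facility met when walking from \<open>W\<close> towards \<open>W'\<close>.  All
  closest-facility reports of \<open>I\<close> lie beyond \<open>P\<close> as seen from \<open>W\<close>, so these reports already favour \<open>P\<close>
  over \<open>W\<close> as much as any report can: the deviation cannot improve \<open>P\<close> relative to \<open>W\<close>.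
  Since the perceived cost is convex and \<open>W'\<close> beats \<open>W\<close> after the deviation, so does \<open>P\<close>, and
  hence \<open>P\<close> beats \<open>W\<close> before the deviation, contradicting the choice of \<open>W\<close>.
\<close>

text \<open>The strict bound in the third fact comes from tie-breaking: a facility to the left that
  tied with the outcome would have been selected instead.\<close>

lemma GM_star_minimal:
  assumes "finite F" "F \<noteq> {}"
  shows "GM_star T L F t x \<in> F"
    and "B \<in> F \<Longrightarrow> perceived_cost T L t x (GM_star T L F t x) \<le> perceived_cost T L t x B"
    and "B \<in> F \<Longrightarrow> B < GM_star T L F t x \<Longrightarrow>
      perceived_cost T L t x (GM_star T L F t x) < perceived_cost T L t x B"
proof -
  let ?f = "perceived_cost T L t x"
  let ?S = "{A \<in> F. \<forall>B\<in>F. ?f A \<le> ?f B}"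
  have fin: "finite ?S" using assms by simp
  obtain A where "A \<in> F" "\<forall>B\<in>F. ?f A \<le> ?f B"
    using ex_is_arg_min_if_finite[of F ?f] assms unfolding is_arg_min_linorder by blast
  then have "?S \<noteq> {}" by blast
  then have W: "GM_star T L F t x \<in> ?S"
    unfolding GM_star_def using Min_in[OF fin] by blast
  then show "GM_star T L F t x \<in> F"
    and min: "\<And>B. B \<in> F \<Longrightarrow> ?f (GM_star T L F t x) \<le> ?f B" by auto
  assume B: "B \<in> F" "B < GM_star T L F t x"
  have "B \<notin> ?S"
    using Min_le[OF fin, of B] B(2) by (auto simp: GM_star_def)
  then obtain D where "D \<in> F" "?f D < ?f B" using B(1) by auto
  with min show "?f (GM_star T L F t x) < ?f B" by fastforce
qed

lemma convex_on_perceived_cost: "convex_on UNIV (perceived_cost T L t x)"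
proof -
  \<comment> \<open>An infinite \<open>S\<close> gives the constant 0.\<close>
  have sum: "convex_on UNIV (\<lambda>A. \<Sum>i\<in>S. dist (y i) A)" for S and y :: "'a \<Rightarrow> real"
    by (induction S rule: infinite_finite_induct)
      (auto simp: convex_on_const intro: convex_on_add[OF convex_on_dist])
  show ?thesis
    using convex_on_add[OF sum sum] by (simp add: perceived_cost_def[abs_def])
qed

text \<open>For any report z, the triangle inequality gives d(z,P) - d(z,W) \<ge> -d(P,W). The
  assumption says that the reports of \<open>I\<close> in \<open>x\<close> attain this bound, so
  changing them can only raise the difference.\<close>

lemma perceived_cost_override_on:
  assumes "finite L"
    and "\<And>i. i \<in> I \<Longrightarrow> dist (x i) W = dist (x i) P + dist P W"
  shows "perceived_cost T L t x P - perceived_cost T L t x W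
    \<le> perceived_cost T L t (override_on x x' I) P - perceived_cost T L t (override_on x x' I) W"
proof -
  have "(\<Sum>i\<in>L. dist (x i) P - dist (x i) W)
      \<le> (\<Sum>i\<in>L. dist (override_on x x' I i) P - dist (override_on x x' I i) W)"
  proof (rule sum_mono)
    fix i
    show "dist (x i) P - dist (x i) W
      \<le> dist (override_on x x' I i) P - dist (override_on x x' I i) W"
      using assms(2)[of i] dist_triangle[of "x' i" W P] by (cases "i \<in> I") auto
  qed
  then show ?thesis by (simp add: perceived_cost_def sum_subtractf)
qed

lemma next_facility:
  fixes W W' :: real
  assumes "finite F" "W' \<in> F" "W' \<noteq> W"
  obtains P where "P \<in> F" "P \<in> closed_segment W W'" "P \<noteq> W"
    "F \<inter> open_segment W P = {}"
proof -
  \<comment> \<open>\<open>W'\<close> itself is a candidate; \<open>P\<close> is the candidate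
    nearest to \<open>W\<close>.\<close>
  let ?S = "F \<inter> closed_segment W W' - {W}"
  have "finite ?S" "?S \<noteq> {}" using assms by auto
  then obtain P where P: "P \<in> ?S" "\<And>A. A \<in> ?S \<Longrightarrow> dist W P \<le> dist W A"
    using ex_is_arg_min_if_finite[of ?S "dist W"] unfolding is_arg_min_linorder by blast
  have "A \<notin> open_segment W P" if "A \<in> F" for A
  proof
    assume A: "A \<in> open_segment W P"
    then have "A \<in> ?S"
      using P(1) that
      by (auto simp: open_segment_eq_real_ivl closed_segment_eq_real_ivl split: if_splits)
    moreover have "dist W A < dist W P"
      using dist_in_open_segment[OF A] by (simp add: dist_commute)
    ultimately show False using P(2)[of A] by simp
  qed
  with P(1) show thesis by (intro that[of P]) auto
qed

text \<open>Here \<open>l\<close> is a true location and \<open>a\<close> its report. As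
  \<open>l\<close> is on the \<open>W'\<close> side of the midpoint of \<open>W\<close> and
  \<open>W'\<close>, any point at or behind \<open>W\<close> is farther from \<open>l\<close> than
  \<open>W'\<close> is. So \<open>a\<close> lies strictly past \<open>W\<close>, and therefore not
  before \<open>P\<close>.\<close>

lemma closest_facility_beyond:
  fixes l a P W W' :: real
  assumes "P \<in> closed_segment W W'" "a \<notin> open_segment W P"
    and "dist l W' < dist l W" "dist l a \<le> dist l W'"
  shows "dist a W = dist a P + dist P W"
proof (cases "W \<le> W'")
  case True
  then have "W \<le> P" "P \<le> a"
    using assms
    by (auto simp: open_segment_eq_real_ivl closed_segment_eq_real_ivl dist_real_def
        split: if_splits)
  then show ?thesis by (simp add: dist_real_def)
next
  case False
  then have "P \<le> W" "a \<le> P"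
    using assms
    by (auto simp: open_segment_eq_real_ivl closed_segment_eq_real_ivl dist_real_def
        split: if_splits)
  then show ?thesis by (simp add: dist_real_def)
qed

theorem theorem4p2:
  fixes C T L :: "'c set"
    and F :: "real set"
    and loc t x :: "'c \<Rightarrow> real"
    and n k :: nat
  assumes "finite C" and "card C = n"
    and "C = T \<union> L" and "T \<inter> L = {}"
    and "card L = k" and "k \<ge> 1"
    and "finite F" and "F \<noteq> {}"
    and "\<And>i. i \<in> T \<Longrightarrow> t i = loc i"
    and "\<And>i. i \<in> L \<Longrightarrow> x i \<in> F"
    and "\<And>i. i \<in> L \<Longrightarrow> dist (loc i) (x i) = Min ((\<lambda>A. dist (loc i) A) ` F)"
  shows "strong_nash_equilibrium L loc (GM_star T L F) t x"
  unfolding strong_nash_equilibrium_def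
proof (intro allI impI, rule ccontr)
  fix I x'
  assume I: "I \<subseteq> L \<and> I \<noteq> {}"
  define y where "y = override_on x x' I"
  define W where "W = GM_star T L F t x"
  define W' where "W' = GM_star T L F t y"
  let ?f = "perceived_cost T L t x" and ?g = "perceived_cost T L t y"
  note W = GM_star_minimal[OF \<open>finite F\<close> \<open>F \<noteq> {}\<close>,
      where T=T and L=L and t=t and x=x, folded W_def]
  note W' = GM_star_minimal[OF \<open>finite F\<close> \<open>F \<noteq> {}\<close>,
      where T=T and L=L and t=t and x=y, folded W'_def]
  assume "\<not> (\<exists>i\<in>I. dist (loc i) (GM_star T L F t x)
      \<le> dist (loc i) (GM_star T L F t (override_on x x' I)))"
  then have better: "dist (loc i) W' < dist (loc i) W" if "i \<in> I" for i
    using that by (auto simp: W_def W'_def y_def)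
  then have "W' \<noteq> W" using I by auto
  then obtain P where P: "P \<in> F" "P \<in> closed_segment W W'" "P \<noteq> W"
    "F \<inter> open_segment W P = {}"
    using next_facility[OF \<open>finite F\<close> W'(1)] by blast
  have "dist (x i) W = dist (x i) P + dist P W" if "i \<in> I" for i
  proof (rule closest_facility_beyond[OF P(2) _ better[OF that]])
    have "i \<in> L" using that I by blast
    then show "x i \<notin> open_segment W P" using assms(10) P(4) by blast
    show "dist (loc i) (x i) \<le> dist (loc i) W'"
      using assms(11)[OF \<open>i \<in> L\<close>] \<open>finite F\<close> W'(1) by simp
  qed
  then have shift: "?f P - ?f W \<le> ?g P - ?g W"
    unfolding y_def using assms(1,3) by (intro perceived_cost_override_on) auto
  obtain u where u: "0 \<le> u" "u \<le> 1" "P = (1 - u) *\<^sub>R W + u *\<^sub>R W'"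
    using P(2) unfolding in_segment by blast
  with P(3) have "0 < u" by (cases "u = 0") auto
  \<comment> \<open>The sign of the change from \<open>W\<close> to \<open>W'\<close> carries over
    to \<open>P\<close>, strictly if it is strict, because \<open>u\<close> is positive.\<close>
  have convex: "?g P - ?g W \<le> u * (?g W' - ?g W)"
    using convex_onD[OF convex_on_perceived_cost[of T L t y], of u W W', OF u(1,2)]
    unfolding u(3)[symmetric] by (simp add: algebra_simps)
  \<comment> \<open>Both cases need one strict inequality, which tie-breaking supplies: for a move
    to the left, before the deviation (\<open>W\<close> against \<open>P\<close>); for a move to the
    right, after it (\<open>W'\<close> against \<open>W\<close>).\<close>
  show False
  proof (cases "W' < W")
    case True
    then have "P < W"
      using P(2,3) by (auto simp: closed_segment_eq_real_ivl)
    then have "?f W < ?f P" by (rule W(3)[OF P(1)])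
    moreover have "u * (?g W' - ?g W) \<le> 0"
      using W'(2)[OF W(1)] \<open>0 < u\<close> by (simp add: mult_nonneg_nonpos)
    ultimately show False using shift convex by linarith
  next
    case False
    then have "?g W' < ?g W"
      using \<open>W' \<noteq> W\<close> by (intro W'(3)[OF W(1)]) auto
    then have "u * (?g W' - ?g W) < 0"
      using \<open>0 < u\<close> by (simp add: mult_pos_neg)
    then show False using shift convex W(2)[OF P(1)] by linarith
  qed
qed

end
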